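(* Let $g\in\{1,2,3,4\}$, let $X$ be a lattice of rank $g$, and let $B$ be a real positive definite symmetric bilinear form on $X_{\mathbf R}=X\otimes\mathbf R$. Then the Delaunay decomposition $\mathrm{Del}_B$ of $X_{\mathbf R}$ is simplicially generating, i.e. every $g$-dimensional $B$-Delaunay cell containing $0$ is simplicially generating. In particular, the nilpotency of $\mathrm{Del}_B$ is equal to one.
   Context: Notation: $\mathbf Z_0$ and $\mathbf R_0$ are the sets of nonnegative integers and nonnegative real numbers. $X$ is a free abelian group of rank $g$ (a lattice), $X_{\mathbf R}=X\otimes\mathbf R$, and $\|x\|=\sqrt{B(x,x)}$ for $x\in X_{\mathbf R}$. For $\alpha\in X_{\mathbf R}$, an element $a\in X$ is nearest to $\alpha$ if $\|a-\alpha\|=\min\{\|b-\alpha\|: b\in X\}$. A (closed) $B$-Delaunay cell is the convex hull of all elements of $X$ nearest to $\alpha$, for some $\alpha\in X_{\mathbf R}$. The $B$-Delaunay cells form a locally finite, $X$-translation-invariant decomposition of $X_{\mathbf R}$ into bounded convex polyhedra, called the Delaunay decomposition $\mathrm{Del}_B$. Its $0$-dimensional cells are exactly the elements of $X$. For a subset $S\subset X_{\mathbf R}$ with $0\in S$, let $C(0,S)$ be the closed cone generated by $S$ over $\mathbf R_0$ and $\mathrm{Semi}(0,S)$ the semigroup generated by $S$ over $\mathbf Z_0$. A bounded closed convex subset $\tau$ of $X_{\mathbf R}$ is integral if it is the convex hull of $\tau\cap X$; every Delaunay cell is integral. Let $\tau$ be a $g$-dimensional integral closed convex subset containing $0$.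 It is called simplicially generating if there exist subsets $\tau_i$ $(i\in I)$ of $\tau$ such that: (1) $0\in\tau_i$ for every $i$, and $\tau_i$, $\tau_j$ have no common interior points for $i\ne j$; (2) $C(0,\tau_i)\cap X=\mathrm{Semi}(0,\tau_i\cap X)$ for every $i$; (3) $C(0,\tau)=\bigcup_{i\in I}C(0,\tau_i)$. Nilpotency: for a $g$-dimensional Delaunay cell $\sigma$ containing $0$, the nilpotency of $\sigma$ is the smallest positive integer $n$ such that the subgroup of $X_{\mathbf R}$ generated by $\frac1n(\sigma\cap X)$ contains $X$; the nilpotency of $\mathrm{Del}_B$ is the least common multiple of the nilpotencies of all $g$-dimensional Delaunay cells containing $0$. *)

theory Defs
  imports "HOL-Analysis.Analysis"
begin

text \<open>
  The space \<open>X\<^sub>R = X \<otimes> R\<close> is an arbitrary type \<open>'a\<close> of class \<open>euclidean_space\<close>, and \<open>X\<close> is the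
  set of integral combinations of some basis of it, so the rank \<open>g\<close> of \<open>X\<close> is \<open>DIM('a)\<close>.
  The inner product of the class only supplies the (canonical) topology of the finite-dimensional
  space; distances in the definition of Delaunay cells are taken with respect to the form \<open>B\<close>.
\<close>

definition int_span :: "'a::real_vector set \<Rightarrow> 'a set" where
  "int_span S = {\<Sum>x\<in>F. real_of_int (c x) *\<^sub>R x | F c. finite F \<and> F \<subseteq> S}"

definition full_lattice :: "'a::euclidean_space set \<Rightarrow> bool" where
  "full_lattice X \<longleftrightarrow> (\<exists>E. independent E \<and> span E = UNIV \<and> X = int_span E)"

definition pos_def_form :: "('a::euclidean_space \<Rightarrow> 'a \<Rightarrow> real) \<Rightarrow> bool" where
  "pos_def_form B \<longleftrightarrow>
     bilinear B \<and> (\<forall>x y. B x y = B y x) \<and> (\<forall>x. x \<noteq> 0 \<longrightarrow> 0 < B x x)"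

definition form_norm :: "('a \<Rightarrow> 'a \<Rightarrow> real) \<Rightarrow> 'a \<Rightarrow> real" where
  "form_norm B x = sqrt (B x x)"

definition nearest :: "'a::euclidean_space set \<Rightarrow> ('a \<Rightarrow> 'a \<Rightarrow> real) \<Rightarrow> 'a \<Rightarrow> 'a set" where
  "nearest X B \<alpha> = {a \<in> X. \<forall>b\<in>X. form_norm B (a - \<alpha>) \<le> form_norm B (b - \<alpha>)}"

definition Delaunay :: "'a::euclidean_space set \<Rightarrow> ('a \<Rightarrow> 'a \<Rightarrow> real) \<Rightarrow> 'a set set" where
  "Delaunay X B = {convex hull (nearest X B \<alpha>) | \<alpha>. True}"

definition full_cells_at_0 :: "'a::euclidean_space set set \<Rightarrow> 'a set set" where
  "full_cells_at_0 D = {\<sigma> \<in> D. aff_dim \<sigma> = int DIM('a) \<and> 0 \<in> \<sigma>}"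

definition closed_cone :: "'a::euclidean_space set \<Rightarrow> 'a set" where
  "closed_cone S = closure (convex_cone hull S)"

definition Semi :: "'a::real_vector set \<Rightarrow> 'a set" where
  "Semi S = {\<Sum>x\<in>F. real (c x) *\<^sub>R x | F (c :: 'a \<Rightarrow> nat). finite F \<and> F \<subseteq> S}"

definition integral_body :: "'a::euclidean_space set \<Rightarrow> 'a set \<Rightarrow> bool" where
  "integral_body X \<tau> \<longleftrightarrow>
     bounded \<tau> \<and> closed \<tau> \<and> convex \<tau> \<and> \<tau> = convex hull (\<tau> \<inter> X)"

text \<open>
  The family \<open>(\<tau>\<^sub>i)\<close> is a set \<open>T\<close> of subsets rather than an indexed family. This is no restriction:
  repeated members of an indexed family may be dropped without affecting any of the conditions.
\<close>

definition simplicially_generating :: "'a::euclidean_space set \<Rightarrow> 'a set \<Rightarrow> bool" where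
  "simplicially_generating X \<tau> \<longleftrightarrow>
     aff_dim \<tau> = int DIM('a) \<and> integral_body X \<tau> \<and> 0 \<in> \<tau> \<and>
     (\<exists>T. (\<forall>S\<in>T. S \<subseteq> \<tau> \<and> 0 \<in> S) \<and>
          pairwise (\<lambda>S S'. interior S \<inter> interior S' = {}) T \<and>
          (\<forall>S\<in>T. closed_cone S \<inter> X = Semi (S \<inter> X)) \<and>
          closed_cone \<tau> = (\<Union>S\<in>T. closed_cone S))"

definition simplicially_generating_decomp ::
    "'a::euclidean_space set \<Rightarrow> 'a set set \<Rightarrow> bool" where
  "simplicially_generating_decomp X D \<longleftrightarrow>
     (\<forall>\<sigma>\<in>full_cells_at_0 D. simplicially_generating X \<sigma>)"

definition nilpotency :: "'a::euclidean_space set \<Rightarrow> 'a set \<Rightarrow> nat" where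
  "nilpotency X \<sigma> =
     (LEAST n. 0 < n \<and> X \<subseteq> int_span ((\<lambda>x. (1 / real n) *\<^sub>R x) ` (\<sigma> \<inter> X)))"

definition nilpotency_decomp :: "'a::euclidean_space set \<Rightarrow> 'a set set \<Rightarrow> nat" where
  "nilpotency_decomp X D = Lcm (nilpotency X ` full_cells_at_0 D)"

end

theory Submission
  imports Defs
begin

text \<open>
  Let \<open>V\<close> be the set of lattice points nearest to \<open>\<alpha>\<close>, with \<open>0 \<in> V\<close>, and let
  \<open>q z = B z z - 2 * B \<alpha> z\<close>, so that \<open>q\<close> is nonnegative on \<open>X\<close> and vanishes there exactly on
  \<open>V\<close>. A mean value identity for \<open>q\<close> shows that a lattice point \<open>y = \<Sum>v\<in>V. f v *\<^sub>R v\<close> with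
  \<open>f \<ge> 0\<close> and \<open>sum f V \<le> 2\<close> is a sum of at most two elements of \<open>V\<close>. Write a lattice point of
  the cone over \<open>V\<close> with nonnegative coefficients of least total sum and linearly independent
  support, and split off the integer parts. The fractional remainder involves at most four
  vectors, and if its coefficient sum exceeded \<open>2\<close>, the complementary point (coefficients
  \<open>1 - d v\<close>) would have sum less than \<open>2\<close>, hence lie in \<open>V\<close> and yield a representation of smaller
  sum. So \<open>V\<close> generates the semigroup of lattice points of its cone.
\<close>

subsection \<open>Conic combinations\<close>

text \<open>Caratheodory reduction that also controls the total: moving along a linear relation on
  the support fixes the represented point and empties one coefficient at a time.\<close>

lemma conic_caratheodory_sum_le:
  fixes V :: "'a::real_vector set" and c :: "'a \<Rightarrow> real"
  assumes "finite V" and "\<And>v. v \<in> V \<Longrightarrow> 0 \<le> c v"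
  obtains d where "\<And>v. v \<in> V \<Longrightarrow> 0 \<le> d v"
    and "(\<Sum>v\<in>V. d v *\<^sub>R v) = (\<Sum>v\<in>V. c v *\<^sub>R v)"
    and "sum d V \<le> sum c V" and "independent {v \<in> V. d v \<noteq> 0}"
proof -
  have "\<exists>d. (\<forall>v\<in>V. 0 \<le> d v) \<and> (\<Sum>v\<in>V. d v *\<^sub>R v) = (\<Sum>v\<in>V. c v *\<^sub>R v) \<and>
      sum d V \<le> sum c V \<and> independent {v \<in> V. d v \<noteq> 0}"
    if "\<forall>v\<in>V. 0 \<le> c v" for c
    using that
  proof (induction "card {v \<in> V. c v \<noteq> 0}" arbitrary: c rule: less_induct)
    case less
    let ?S = "{v \<in> V. c v \<noteq> 0}"
    show ?case
    proof (cases "independent ?S")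
      case True
      then show ?thesis using less.prems by blast
    next
      case False
      have finS: "finite ?S" using assms(1) by simp
      obtain u0 where u0: "\<exists>v\<in>?S. u0 v \<noteq> 0" "(\<Sum>v\<in>?S. u0 v *\<^sub>R v) = 0"
        using False dependent_finite[OF finS] by auto
      \<comment> \<open>Of the two signs, the one with nonnegative sum is taken: subtracting a
        nonnegative multiple of \<open>u\<close> then cannot raise the total.\<close>
      define u where "u = (if 0 \<le> sum u0 ?S then u0 else (\<lambda>v. - u0 v))"
      have u: "\<exists>v\<in>?S. u v \<noteq> 0" "(\<Sum>v\<in>?S. u v *\<^sub>R v) = 0" "0 \<le> sum u ?S"
        using u0 by (auto simp: u_def sum_negf)
      have "\<exists>v\<in>?S. 0 < u v"
      proof (rule ccontr)
        assume *: "\<not> ?thesis"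
        obtain w where w: "w \<in> ?S" "u w \<noteq> 0" using u(1) by blast
        have "sum u ?S < sum (\<lambda>_. 0) ?S"
          by (rule sum_strict_mono_ex1[OF finS]) (use * w in force)+
        then show False using u(3) by simp
      qed
      then have ne: "{v \<in> ?S. 0 < u v} \<noteq> {}" by blast
      \<comment> \<open>Ratio test: \<open>t\<close> is the largest step keeping all coefficients
        nonnegative. At the minimising \<open>w\<close> the coefficient vanishes, so the support
        shrinks.\<close>
      define t where "t = Min ((\<lambda>v. c v / u v) ` {v \<in> ?S. 0 < u v})"
      have fin': "finite ((\<lambda>v. c v / u v) ` {v \<in> ?S. 0 < u v})"
      using assms(1) by (intro finite_imageI) simp
      obtain w where w: "w \<in> ?S" "0 < u w" "t = c w / u w"
        using Min_in[OF fin'] ne unfolding t_def by blast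
      have tle: "t \<le> c v / u v" if "v \<in> ?S" "0 < u v" for v
        unfolding t_def by (rule Min_le[OF fin']) (use that in blast)
      have t0: "0 \<le> t" using w less.prems by simp
      define d where "d v = (if v \<in> ?S then c v - t * u v else 0)" for v
      have d0: "\<forall>v\<in>V. 0 \<le> d v"
      proof
        fix v assume v: "v \<in> V"
        show "0 \<le> d v"
        proof (cases "v \<in> ?S \<and> 0 < u v")
          case True
          then show ?thesis using tle[of v] by (simp add: d_def field_simps)
        next
          case False
          have "t * u v \<le> 0" if "v \<in> ?S"
            using False that t0 by (simp add: mult_nonneg_nonpos)
          then show ?thesis using v less.prems by (force simp: d_def)
        qed
      qed
      have "d w = 0" using w by (simp add: d_def)
      moreover have "{v \<in> V. d v \<noteq> 0} \<subseteq> ?S" by (auto simp: d_def)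
      ultimately have "{v \<in> V. d v \<noteq> 0} \<subset> ?S" using w(1) by blast
      then have "card {v \<in> V. d v \<noteq> 0} < card ?S" by (rule psubset_card_mono[OF finS])
      from less.hyps[OF this d0] obtain e where e: "\<forall>v\<in>V. 0 \<le> e v"
        "(\<Sum>v\<in>V. e v *\<^sub>R v) = (\<Sum>v\<in>V. d v *\<^sub>R v)"
        "sum e V \<le> sum d V" "independent {v \<in> V. e v \<noteq> 0}" by blast
      have "(\<Sum>v\<in>V. d v *\<^sub>R v) = (\<Sum>v\<in>?S. d v *\<^sub>R v)"
        by (rule sum.mono_neutral_right) (use assms(1) in \<open>auto simp: d_def\<close>)
      also have "\<dots> = (\<Sum>v\<in>?S. c v *\<^sub>R v) - t *\<^sub>R (\<Sum>v\<in>?S. u v *\<^sub>R v)"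
        by (simp add: d_def scaleR_diff_left sum_subtractf scaleR_sum_right)
      also have "\<dots> = (\<Sum>v\<in>?S. c v *\<^sub>R v)" by (simp only: u(2)) simp
      also have "\<dots> = (\<Sum>v\<in>V. c v *\<^sub>R v)"
        by (rule sum.mono_neutral_left) (use assms(1) in auto)
      finally have 1: "(\<Sum>v\<in>V. d v *\<^sub>R v) = (\<Sum>v\<in>V. c v *\<^sub>R v)" .
      have "sum d V = sum d ?S"
        by (rule sum.mono_neutral_right) (use assms(1) in \<open>auto simp: d_def\<close>)
      also have "\<dots> = sum c ?S - t * sum u ?S"
        by (simp add: d_def sum_subtractf sum_distrib_left)
      also have "\<dots> \<le> sum c ?S" using t0 u(3) by simp
      also have "\<dots> = sum c V"
        by (rule sum.mono_neutral_left) (use assms(1) in auto)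
      finally have 2: "sum d V \<le> sum c V" .
      show ?thesis
        by (intro exI[of _ e] conjI) (use e 1 2 in auto)
    qed
  qed
  from this[of c] assms(2) show ?thesis using that by blast
qed

text \<open>An independent support determines the coefficients, so each subset of \<open>V\<close>
  contributes at most one total. The least of these finitely many totals is the least over all
  representations by the Caratheodory reduction.\<close>

lemma minimal_conic_representation:
  fixes V :: "'a::real_vector set" and c :: "'a \<Rightarrow> real"
  assumes V: "finite V" and c: "\<And>v. v \<in> V \<Longrightarrow> 0 \<le> c v"
  shows "\<exists>d. (\<forall>v\<in>V. 0 \<le> d v) \<and> (\<Sum>v\<in>V. d v *\<^sub>R v) = (\<Sum>v\<in>V. c v *\<^sub>R v) \<and>
    independent {v \<in> V. d v \<noteq> 0} \<and>
    (\<forall>e. (\<forall>v\<in>V. 0 \<le> e v) \<longrightarrow> (\<Sum>v\<in>V. e v *\<^sub>R v) = (\<Sum>v\<in>V. c v *\<^sub>R v) \<longrightarrow>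
      sum d V \<le> sum e V)"
proof -
  define x where "x = (\<Sum>v\<in>V. c v *\<^sub>R v)"
  define R where "R = {d. (\<forall>v\<in>V. 0 \<le> d v) \<and> (\<Sum>v\<in>V. d v *\<^sub>R v) = x \<and>
    independent {v \<in> V. d v \<noteq> 0}}"
  have uniq: "sum d V = sum e V"
    if d: "d \<in> R" and e: "e \<in> R" and eq: "{v \<in> V. d v \<noteq> 0} = {v \<in> V. e v \<noteq> 0}" for d e
  proof -
    let ?S = "{v \<in> V. d v \<noteq> 0}"
    have fS: "finite ?S" using V by simp
    have "(\<Sum>v\<in>?S. (d v - e v) *\<^sub>R v) = (\<Sum>v\<in>V. (d v - e v) *\<^sub>R v)"
      by (rule sum.mono_neutral_left) (use V eq in auto)
    also have "\<dots> = 0" using d e by (simp add: R_def scaleR_diff_left sum_subtractf)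
    finally have 0: "(\<Sum>v\<in>?S. (d v - e v) *\<^sub>R v) = 0" .
    have "independent ?S" using d by (simp add: R_def)
    then have "\<forall>v\<in>?S. d v - e v = 0" using independentD[OF _ fS subset_refl 0] by blast
    moreover have "sum d V = sum d ?S" by (rule sum.mono_neutral_right) (use V in auto)
    moreover have "sum e V = sum e ?S" by (rule sum.mono_neutral_right) (use V eq in auto)
    ultimately show ?thesis by simp
  qed
  \<comment> \<open>One representation is chosen per support; by \<open>uniq\<close> its total
    stands for all others with that support.\<close>
  define rep where "rep S = (SOME d. d \<in> R \<and> {v \<in> V. d v \<noteq> 0} = S)" for S
  have "(\<lambda>d. sum d V) ` R \<subseteq> (\<lambda>S. sum (rep S) V) ` Pow V"
  proof
    fix s assume "s \<in> (\<lambda>d. sum d V) ` R"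
    then obtain d where d: "d \<in> R" "s = sum d V" by blast
    let ?S = "{v \<in> V. d v \<noteq> 0}"
    have *: "rep ?S \<in> R \<and> {v \<in> V. rep ?S v \<noteq> 0} = ?S"
      unfolding rep_def by (rule someI[of _ d]) (use d in simp)
    have "sum d V = sum (rep ?S) V"
      by (rule uniq[OF d(1) conjunct1[OF *] conjunct2[OF *, symmetric]])
    then show "s \<in> (\<lambda>S. sum (rep S) V) ` Pow V" unfolding d(2) by (rule image_eqI) blast
  qed
  then have fin: "finite ((\<lambda>d. sum d V) ` R)"
    by (rule finite_subset) (use V in simp)
  have reduce: "\<exists>d\<in>R. sum d V \<le> sum e V"
    if e: "\<And>v. v \<in> V \<Longrightarrow> 0 \<le> e v" "(\<Sum>v\<in>V. e v *\<^sub>R v) = x" for e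
  proof -
    obtain d where d: "\<And>v. v \<in> V \<Longrightarrow> 0 \<le> d v" "(\<Sum>v\<in>V. d v *\<^sub>R v) = (\<Sum>v\<in>V. e v *\<^sub>R v)"
      "sum d V \<le> sum e V" "independent {v \<in> V. d v \<noteq> 0}"
      using conic_caratheodory_sum_le[of V e, OF V e(1)] by blast
    then have "d \<in> R" "sum d V \<le> sum e V" using e(2) by (simp_all add: R_def)
    then show ?thesis by blast
  qed
  have ne: "(\<lambda>d. sum d V) ` R \<noteq> {}" using reduce[OF c x_def[symmetric]] by blast
  obtain d where d: "d \<in> R" "sum d V = Min ((\<lambda>d. sum d V) ` R)"
    using Min_in[OF fin ne] by force
  have "sum d V \<le> sum e V"
    if e: "\<And>v. v \<in> V \<Longrightarrow> 0 \<le> e v" "(\<Sum>v\<in>V. e v *\<^sub>R v) = x" for e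
  proof -
    obtain d' where d': "d' \<in> R" "sum d' V \<le> sum e V" using reduce[OF e] by blast
    have "sum d V \<le> sum d' V" unfolding d(2) by (rule Min_le[OF fin]) (use d' in blast)
    then show ?thesis using d' by simp
  qed
  moreover have "(\<forall>v\<in>V. 0 \<le> d v) \<and> (\<Sum>v\<in>V. d v *\<^sub>R v) = x \<and> independent {v \<in> V. d v \<noteq> 0}"
    using d(1) by (simp add: R_def)
  ultimately show ?thesis unfolding x_def by (intro exI[of _ d]) simp
qed

lemma convex_cone_hull_finite:
  fixes V :: "'a::real_vector set"
  assumes "finite V"
  shows "convex_cone hull V = {\<Sum>v\<in>V. c v *\<^sub>R v | c. \<forall>v\<in>V. 0 \<le> c v}"
proof
  show "convex_cone hull V \<subseteq> {\<Sum>v\<in>V. c v *\<^sub>R v | c. \<forall>v\<in>V. 0 \<le> c v}"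
  proof (cases "V = {}")
    case True
    then show ?thesis by simp
  next
    case False
    show ?thesis
      unfolding convex_cone_hull_convex_hull_nonempty[OF False] convex_hull_finite[OF assms]
    proof clarsimp
      fix u :: "'a \<Rightarrow> real" and k :: real assume "\<forall>v\<in>V. 0 \<le> u v" "0 \<le> k"
      then show "\<exists>c. k *\<^sub>R (\<Sum>v\<in>V. u v *\<^sub>R v) = (\<Sum>v\<in>V. c v *\<^sub>R v) \<and> (\<forall>v\<in>V. 0 \<le> c v)"
        by (intro exI[of _ "\<lambda>v. k * u v"]) (simp add: scaleR_sum_right)
    qed
  qed
  show "{\<Sum>v\<in>V. c v *\<^sub>R v | c. \<forall>v\<in>V. 0 \<le> c v} \<subseteq> convex_cone hull V"
  proof clarify
    fix c :: "'a \<Rightarrow> real" assume c: "\<forall>v\<in>V. 0 \<le> c v"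
    have "(\<Sum>v\<in>F. c v *\<^sub>R v) \<in> convex_cone hull V" if "F \<subseteq> V" for F
      using finite_subset[OF that assms] that
      by (induction rule: finite_induct)
        (use c in \<open>auto intro!: convex_cone_hull_add intro: convex_cone_hull_mul hull_inc
          simp: convex_cone_hull_contains_0\<close>)
    then show "(\<Sum>v\<in>V. c v *\<^sub>R v) \<in> convex_cone hull V" by blast
  qed
qed

text \<open>A finitely generated cone is already closed, and taking the convex hull of the
  generators does not enlarge it.\<close>

lemma closed_cone_convex_hull_finite:
  assumes "finite V"
  shows "closed_cone (convex hull V) = convex_cone hull V"
proof -
  have "convex_cone hull (convex hull V) = convex_cone hull V"
    by (simp add: convex_cone_hull_separate hull_hull)
  then show ?thesis
    using closed_convex_cone_hull[OF assms] by (simp add: closed_cone_def)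
qed

subsection \<open>Lattices and semigroups\<close>

lemma int_span_finite:
  assumes "finite S"
  shows "int_span S = {\<Sum>x\<in>S. real_of_int (c x) *\<^sub>R x | c. True}"
proof -
  have "\<exists>c'. (\<Sum>x\<in>F. real_of_int (c x) *\<^sub>R x) = (\<Sum>x\<in>S. real_of_int (c' x) *\<^sub>R x)"
    if "F \<subseteq> S" for F and c :: "'a \<Rightarrow> int"
    by (rule exI[of _ "\<lambda>x. if x \<in> F then c x else 0"], rule sum.mono_neutral_cong_left)
      (use assms that in auto)
  then show ?thesis unfolding int_span_def using assms by blast
qed

lemma Semi_finite:
  assumes "finite S"
  shows "Semi S = {\<Sum>x\<in>S. real (c x) *\<^sub>R x | c. True}"
proof -
  have "\<exists>c'. (\<Sum>x\<in>F. real (c x) *\<^sub>R x) = (\<Sum>x\<in>S. real (c' x) *\<^sub>R x)"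
    if "F \<subseteq> S" for F and c :: "'a \<Rightarrow> nat"
    by (rule exI[of _ "\<lambda>x. if x \<in> F then c x else 0"], rule sum.mono_neutral_cong_left)
      (use assms that in auto)
  then show ?thesis unfolding Semi_def using assms by blast
qed

lemma Semi_incl: "x \<in> S \<Longrightarrow> x \<in> Semi S"
  unfolding Semi_def by (rule CollectI, intro exI[of _ "{x}"] exI[of _ "\<lambda>_. 1"]) simp

lemma Semi_add:
  assumes "finite S" "x \<in> Semi S" "y \<in> Semi S"
  shows "x + y \<in> Semi S"
proof -
  obtain c d where "x = (\<Sum>x\<in>S. real (c x) *\<^sub>R x)" "y = (\<Sum>x\<in>S. real (d x) *\<^sub>R x)"
    using assms by (auto simp: Semi_finite)
  then have "x + y = (\<Sum>x\<in>S. real (c x + d x) *\<^sub>R x)"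
    by (simp add: scaleR_add_left sum.distrib)
  then show ?thesis unfolding Semi_finite[OF assms(1)]
    by (intro CollectI exI[of _ "\<lambda>x. c x + d x"]) simp
qed

lemma int_span_diff:
  assumes "finite S" "x \<in> int_span S" "y \<in> int_span S"
  shows "x - y \<in> int_span S"
proof -
  obtain c d where "x = (\<Sum>x\<in>S. real_of_int (c x) *\<^sub>R x)" "y = (\<Sum>x\<in>S. real_of_int (d x) *\<^sub>R x)"
    using assms by (auto simp: int_span_finite)
  then have "x - y = (\<Sum>x\<in>S. real_of_int (c x - d x) *\<^sub>R x)"
    by (simp add: scaleR_diff_left sum_subtractf)
  then show ?thesis unfolding int_span_finite[OF assms(1)]
    by (intro CollectI exI[of _ "\<lambda>x. c x - d x"]) simp
qed

lemma Semi_subset_int_span: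
  assumes "finite S"
  shows "Semi S \<subseteq> int_span S"
proof
  fix x assume "x \<in> Semi S"
  then obtain c where "x = (\<Sum>x\<in>S. real (c x) *\<^sub>R x)" using assms by (auto simp: Semi_finite)
  then have "x = (\<Sum>x\<in>S. real_of_int (int (c x)) *\<^sub>R x)" by simp
  then show "x \<in> int_span S"
    unfolding int_span_finite[OF assms(1)]
    by (intro CollectI exI[of _ "\<lambda>x. int (c x)"]) simp
qed

lemma full_lattice_diff:
  assumes "full_lattice X" "x \<in> X" "y \<in> X"
  shows "x - y \<in> X"
  using assms int_span_diff independent_imp_finite unfolding full_lattice_def by metis

lemma full_lattice_0: "full_lattice X \<Longrightarrow> 0 \<in> X"
  unfolding full_lattice_def int_span_def by (force intro!: exI[of _ "{}"])

lemma full_lattice_add: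
  assumes "full_lattice X" "x \<in> X" "y \<in> X"
  shows "x + y \<in> X"
  using full_lattice_diff[OF assms(1,2) full_lattice_diff[OF assms(1) full_lattice_0[OF assms(1)] assms(3)]]
  by simp

lemma full_lattice_of_nat:
  assumes "full_lattice X" "x \<in> X"
  shows "real n *\<^sub>R x \<in> X"
  by (induction n) (use assms in \<open>auto simp: full_lattice_0 scaleR_add_left intro: full_lattice_add\<close>)

lemma full_lattice_sum:
  assumes "full_lattice X" "\<And>v. v \<in> F \<Longrightarrow> f v \<in> X"
  shows "sum f F \<in> X"
  using assms(2)
  by (induction F rule: infinite_finite_induct)
    (auto simp: full_lattice_0[OF assms(1)] intro: full_lattice_add[OF assms(1)])

text \<open>Coordinates in a lattice basis are linear, hence bounded on a bounded set; on lattice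
  points they are integers, which leaves finitely many choices.\<close>

lemma finite_lattice_bounded:
  fixes X :: "'a::euclidean_space set"
  assumes X: "full_lattice X" and S: "bounded S"
  shows "finite (S \<inter> X)"
proof -
  obtain E where E: "independent E" "span E = UNIV" "X = int_span E"
    using X unfolding full_lattice_def by blast
  have finE: "finite E" using E(1) by (rule independent_imp_finite)
  let ?r = "\<lambda>x e. representation E x e"
  have "bounded ((\<lambda>x. ?r x e) ` S)" for e
  proof (rule bounded_linear_image[OF S])
    show "bounded_linear (\<lambda>x. ?r x e)"
      by (intro linear_conv_bounded_linear[THEN iffD1] linearI)
        (use E in \<open>auto simp: representation_add representation_scale\<close>)
  qed
  then have "\<forall>e. \<exists>N. \<forall>x\<in>S. \<bar>?r x e\<bar> \<le> N" by (force simp: bounded_iff)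
  then obtain N where N: "\<And>e x. x \<in> S \<Longrightarrow> \<bar>?r x e\<bar> \<le> N e" by metis
  define P where "P = PiE E (\<lambda>e. {-\<lceil>N e\<rceil>..\<lceil>N e\<rceil>})"
  have "finite P" unfolding P_def using finE by (intro finite_PiE) auto
  moreover have "S \<inter> X \<subseteq> (\<lambda>c. \<Sum>e\<in>E. real_of_int (c e) *\<^sub>R e) ` P"
  proof
    fix x assume x: "x \<in> S \<inter> X"
    then obtain c where c: "x = (\<Sum>e\<in>E. real_of_int (c e) *\<^sub>R e)"
      using E(3) int_span_finite[OF finE] by auto
    have "(\<Sum>e\<in>E. ?r x e *\<^sub>R e) = x"
      by (rule sum_representation_eq) (use E finE in auto)
    then have diff: "(\<Sum>e\<in>E. (?r x e - c e) *\<^sub>R e) = 0"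
      unfolding scaleR_diff_left sum_subtractf using c by simp
    have r: "?r x e = c e" if "e \<in> E" for e
    proof -
      have "?r x e - c e = 0"
        by (rule independentD[OF E(1) finE subset_refl diff that])
      then show ?thesis by simp
    qed
    have "\<bar>c e\<bar> \<le> \<lceil>N e\<rceil>" if "e \<in> E" for e
    proof -
      have "\<bar>real_of_int (c e)\<bar> \<le> N e" using N[of x e] x r[OF that] by simp
      then show ?thesis by linarith
    qed
    \<comment> \<open>Members of \<open>PiE\<close> take the value \<open>undefined\<close> outside
      \<open>E\<close>, hence the restriction.\<close>
    then have "restrict c E \<in> P" by (force simp: P_def abs_le_iff)
    moreover have "x = (\<Sum>e\<in>E. real_of_int (restrict c E e) *\<^sub>R e)" using c by simp
    ultimately show "x \<in> (\<lambda>c. \<Sum>e\<in>E. real_of_int (c e) *\<^sub>R e) ` P" by blast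
  qed
  ultimately show ?thesis by (rule finite_surj)
qed

text \<open>The constant is the minimum of \<open>B x x\<close> on the unit sphere, attained by
  compactness; homogeneity of degree 2 extends the bound to all vectors.\<close>

lemma pos_def_form_coercive:
  fixes B :: "'a::euclidean_space \<Rightarrow> 'a \<Rightarrow> real"
  assumes "pos_def_form B"
  obtains m where "0 < m" and "\<And>x. m * (norm x)\<^sup>2 \<le> B x x"
proof -
  have B: "bounded_bilinear B" and pos: "\<And>x. x \<noteq> 0 \<Longrightarrow> 0 < B x x"
    using assms unfolding pos_def_form_def by (auto simp: bilinear_conv_bounded_bilinear)
  interpret bounded_bilinear B by fact
  have cont: "continuous_on (sphere 0 1) (\<lambda>x. B x x)"
    by (intro continuous_on continuous_on_id)
  have "sphere (0::'a) 1 \<noteq> {}" by simp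
  then obtain z where z: "z \<in> sphere 0 1" "\<And>y. y \<in> sphere 0 1 \<Longrightarrow> B z z \<le> B y y"
    using continuous_attains_inf[OF compact_sphere _ cont] by blast
  have "B z z * (norm x)\<^sup>2 \<le> B x x" for x
  proof (cases "x = 0")
    case False
    define y where "y = (1 / norm x) *\<^sub>R x"
    have "B z z \<le> B y y" by (rule z) (use False in \<open>simp add: y_def\<close>)
    also have "\<dots> = B x x / (norm x)\<^sup>2" by (simp add: y_def scaleR_left scaleR_right power2_eq_square)
    finally show ?thesis using False by (simp add: field_simps)
  qed (simp add: zero_left)
  moreover have "0 < B z z" using z(1) by (intro pos) auto
  ultimately show ?thesis using that by blast
qed

subsection \<open>Delaunay cells containing the origin\<close>

text \<open>Membership of 0 is assumed in the form in which cells provide it;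
  \<open>zero_in_V\<close> upgrades it to 0 being itself a nearest point.\<close>

locale cell_at_0 =
  fixes X :: "'a::euclidean_space set" and B :: "'a \<Rightarrow> 'a \<Rightarrow> real" and \<alpha> :: 'a
  assumes lattice: "full_lattice X" and form: "pos_def_form B"
    and zero_in_cell: "0 \<in> convex hull (nearest X B \<alpha>)"
begin

section \<open>The quadratic function \<open>q\<close> and the lattice points of a cell\<close>

abbreviation V where "V \<equiv> nearest X B \<alpha>"

text \<open>This is the squared \<open>B\<close>-distance from \<open>z\<close> to \<alpha> without
  the constant \<open>B \<alpha> \<alpha>\<close>: the minimisers are the same, and
  \<open>q 0 = 0\<close>.\<close>

definition q :: "'a \<Rightarrow> real" where "q z = B z z - 2 * B \<alpha> z"

lemma B_bounded_bilinear: "bounded_bilinear B"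
  using form unfolding pos_def_form_def by (simp add: bilinear_conv_bounded_bilinear)

sublocale B: bounded_bilinear B by (rule B_bounded_bilinear)

lemma B_sym: "B x y = B y x" using form unfolding pos_def_form_def by metis

lemma B_pos: "x \<noteq> 0 \<Longrightarrow> 0 < B x x" using form unfolding pos_def_form_def by blast

lemma B_nonneg: "0 \<le> B x x" by (metis B_pos B.zero_left less_eq_real_def)

lemma form_norm_le_iff: "form_norm B (x - \<alpha>) \<le> form_norm B (y - \<alpha>) \<longleftrightarrow> q x \<le> q y"
  by (simp add: form_norm_def q_def B.diff_left B.diff_right B_sym[of x \<alpha>]
      B_sym[of y \<alpha>])

lemma V_iff: "z \<in> V \<longleftrightarrow> z \<in> X \<and> (\<forall>b\<in>X. q z \<le> q b)"
  by (simp add: nearest_def form_norm_le_iff)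

lemma V_subset: "V \<subseteq> X"
  by (auto simp: nearest_def)

text \<open>On a segment \<open>q\<close> falls short of linear interpolation by
  \<open>u * v * B (x - y) (x - y)\<close>, which is nonnegative.\<close>

lemma convex_sublevel: "convex {z. q z \<le> r}"
proof (rule convexI)
  fix x y and u v :: real
  assume xy: "x \<in> {z. q z \<le> r}" "y \<in> {z. q z \<le> r}" and *: "0 \<le> u" "0 \<le> v" "u + v = 1"
  have v: "v = 1 - u" using *(3) by simp
  have 1: "B (u *\<^sub>R x + v *\<^sub>R y) (u *\<^sub>R x + v *\<^sub>R y) = u\<^sup>2 * B x x + 2 * (u * v * B x y) + v\<^sup>2 * B y y"
    by (simp add: B.add_left B.add_right B.scaleR_left B.scaleR_right B_sym[of y x]
        power2_eq_square algebra_simps)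
  have 2: "B \<alpha> (u *\<^sub>R x + v *\<^sub>R y) = u * B \<alpha> x + v * B \<alpha> y"
    by (simp add: B.add_right B.scaleR_right)
  have 3: "B (x - y) (x - y) = B x x - 2 * B x y + B y y"
    by (simp add: B.diff_left B.diff_right B_sym[of y x])
  have "q (u *\<^sub>R x + v *\<^sub>R y) = u * q x + v * q y - u * v * B (x - y) (x - y)"
    unfolding q_def 1 2 3 by (simp add: v power2_eq_square algebra_simps)
  also have "\<dots> \<le> u * q x + v * q y" using *(1,2) B_nonneg by simp
  also have "\<dots> \<le> u * r + v * r" using * xy by (intro add_mono mult_left_mono) auto
  also have "\<dots> = r" by (simp add: v algebra_simps)
  finally show "u *\<^sub>R x + v *\<^sub>R y \<in> {z. q z \<le> r}" by simp
qed

text \<open>\<open>V\<close> lies in the convex sublevel set of the minimum of \<open>q\<close> over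
  \<open>X\<close>, hence so does its hull; a lattice point there is again a minimiser.\<close>

lemma cell_lattice_points: "convex hull V \<inter> X = V"
proof
  show "V \<subseteq> convex hull V \<inter> X" using hull_subset[of V convex] V_subset by simp
  show "convex hull V \<inter> X \<subseteq> V"
  proof
    fix z assume z: "z \<in> convex hull V \<inter> X"
    then have "V \<noteq> {}" by auto
    then obtain a where a: "a \<in> V" by blast
    then have min: "q a \<le> q b" if "b \<in> X" for b using that V_iff[of a] by simp
    have "V \<subseteq> {z. q z \<le> q a}"
    proof
      fix v assume "v \<in> V"
      then show "v \<in> {z. q z \<le> q a}" using V_iff[of v] V_iff[of a] a by simp
    qed
    then have "convex hull V \<subseteq> {z. q z \<le> q a}" by (intro hull_minimal convex_sublevel)
    then have "q z \<le> q a" using z by blast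
    then show "z \<in> V" using z min order_trans unfolding V_iff by blast
  qed
qed

lemma zero_in_V: "0 \<in> V"
  using cell_lattice_points zero_in_cell full_lattice_0[OF lattice] by blast

lemma q_nonneg: "z \<in> X \<Longrightarrow> 0 \<le> q z"
  using zero_in_V V_iff[of 0] by (simp add: q_def B.zero_left B.zero_right)

lemma V_iff_q: "z \<in> V \<longleftrightarrow> z \<in> X \<and> q z = 0"
proof
  assume "z \<in> V"
  then have "z \<in> X" "q z \<le> q 0" using V_iff full_lattice_0[OF lattice] by auto
  then show "z \<in> X \<and> q z = 0" using q_nonneg[of z] by (simp add: q_def B.zero_left B.zero_right)
qed (auto simp: V_iff intro: q_nonneg)

text \<open>On \<open>V\<close> the equation \<open>q v = 0\<close> bounds a quantity quadratic in
  \<open>norm v\<close> by a linear one, so \<open>V\<close> is a bounded set of lattice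
  points.\<close>

lemma finite_V: "finite V"
proof -
  obtain m where m: "0 < m" "\<And>x. m * (norm x)\<^sup>2 \<le> B x x"
    using pos_def_form_coercive[OF form] by blast
  obtain K where K0: "0 \<le> K" and K: "\<And>a b. norm (B a b) \<le> norm a * norm b * K"
    using B.nonneg_bounded by auto
  have "norm v \<le> 2 * (norm \<alpha> * K) / m" if "v \<in> V" for v
  proof (cases "v = 0")
    case True
    then show ?thesis using K0 m by simp
  next
    case False
    have "q v = 0" using that V_iff_q by blast
    then have "m * (norm v)\<^sup>2 \<le> 2 * B \<alpha> v" using m(2)[of v] by (simp add: q_def)
    also have "\<dots> \<le> 2 * (norm \<alpha> * norm v * K)" using K[of \<alpha> v] by simp
    finally have "norm v * (m * norm v) \<le> norm v * (2 * (norm \<alpha> * K))"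
      by (simp add: power2_eq_square mult_ac)
    then have "m * norm v \<le> 2 * (norm \<alpha> * K)" using False by simp
    then show ?thesis using m(1) by (simp add: field_simps)
  qed
  then have "bounded V" by (force simp: bounded_iff)
  then have "finite (V \<inter> X)" by (rule finite_lattice_bounded[OF lattice])
  then show ?thesis using V_subset by (simp add: inf_absorb1)
qed

section \<open>Rounding of lattice points with small coefficient sum\<close>

lemma B_sum_V: "(\<Sum>v\<in>V. f v * B v v) = 2 * B \<alpha> (\<Sum>v\<in>V. f v *\<^sub>R v)"
proof -
  have "B v v = 2 * B \<alpha> v" if "v \<in> V" for v using that V_iff_q by (simp add: q_def)
  then show ?thesis by (simp add: B.sum_right B.scaleR_right sum_distrib_left mult_ac)
qed

text \<open>Randomly subtracting \<open>v\<close> with probability \<open>f v / 2\<close>, and nothing otherwise, gives lattice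
  points on which \<open>q\<close> vanishes in the mean; as \<open>q\<close> is nonnegative on \<open>X\<close>, they all lie in \<open>V\<close>.\<close>

lemma rounding_identity:
  assumes "y = (\<Sum>v\<in>V. f v *\<^sub>R v)"
  shows "(2 - sum f V) * q y + (\<Sum>v\<in>V. f v * q (y - v)) = 0"
proof -
  have eq: "q (y - v) = q y - 2 * B y v + 2 * B v v" if "v \<in> V" for v
    using that V_iff_q[of v]
    by (simp add: q_def B.diff_left B.diff_right B_sym[of v y])
  have "(\<Sum>v\<in>V. f v * q (y - v)) = (\<Sum>v\<in>V. f v * q y - 2 * (f v * B y v) + 2 * (f v * B v v))"
    by (intro sum.cong refl) (simp add: eq algebra_simps)
  also have "\<dots> = sum f V * q y - 2 * (\<Sum>v\<in>V. f v * B y v) + 2 * (\<Sum>v\<in>V. f v * B v v)"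
    by (simp add: sum.distrib sum_subtractf sum_distrib_right flip: sum_distrib_left)
  also have "(\<Sum>v\<in>V. f v * B y v) = B y y"
    by (subst (3) assms) (simp add: B.sum_right B.scaleR_right)
  also have "(\<Sum>v\<in>V. f v * B v v) = 2 * B \<alpha> y" by (simp add: B_sum_V assms)
  finally show ?thesis by (simp add: q_def algebra_simps)
qed

text \<open>All terms of \<open>rounding_identity\<close> are nonnegative here, the bound 2 taking
  care of the weight \<open>2 - sum f V\<close>. So each term vanishes, and \<open>q\<close> is zero
  wherever the weight is positive.\<close>

lemma rounding:
  assumes f: "\<And>v. v \<in> V \<Longrightarrow> 0 \<le> f v" and y: "y = (\<Sum>v\<in>V. f v *\<^sub>R v)" and yX: "y \<in> X"
    and le: "sum f V \<le> 2"
  shows "sum f V < 2 \<Longrightarrow> y \<in> V"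
    and "v \<in> V \<Longrightarrow> 0 < f v \<Longrightarrow> y - v \<in> V"
proof -
  have X: "y - v \<in> X" if "v \<in> V" for v
    using full_lattice_diff[OF lattice yX] that V_subset by blast
  have nn: "0 \<le> f v * q (y - v)" if "v \<in> V" for v using f q_nonneg X that by simp
  have a: "0 \<le> (2 - sum f V) * q y" using le q_nonneg[OF yX] by simp
  have b: "0 \<le> (\<Sum>v\<in>V. f v * q (y - v))" by (intro sum_nonneg nn)
  have ab: "(2 - sum f V) * q y = 0" "(\<Sum>v\<in>V. f v * q (y - v)) = 0"
    using rounding_identity[OF y] a b by linarith+
  show "y \<in> V" if "sum f V < 2" using ab(1) that yX V_iff_q by simp
  show "y - v \<in> V" if "v \<in> V" "0 < f v"
  proof -
    have "f v * q (y - v) = 0" 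
      by (rule sum_nonneg_0[where f = "\<lambda>v. f v * q (y - v)", OF finite_V nn ab(2) that(1)])
    then show ?thesis using that X V_iff_q by simp
  qed
qed

text \<open>The \<open>f\<close>-weighted sum of squared distances from \<open>y\<close> to points
  of \<open>V\<close> equals \<open>(sum f V - 1) * B y y\<close>, since \<open>q y = 0\<close>
  turns \<open>2 * B \<alpha> y\<close> into \<open>B y y\<close>. The term of \<open>w\<close>
  makes it positive.\<close>

lemma sum_gt_1:
  assumes f: "\<And>v. v \<in> V \<Longrightarrow> 0 \<le> f v" and y: "y = (\<Sum>v\<in>V. f v *\<^sub>R v)" and yV: "y \<in> V"
    and w: "w \<in> V" "0 < f w" "w \<noteq> y"
  shows "1 < sum f V"
proof -
  have "0 < f w * B (w - y) (w - y)" using w B_pos[of "w - y"] by simp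
  also have "\<dots> \<le> (\<Sum>v\<in>V. f v * B (v - y) (v - y))"
    by (rule member_le_sum) (use w f B_nonneg finite_V in auto)
  also have "\<dots> = (\<Sum>v\<in>V. f v * B v v - 2 * (f v * B y v) + f v * B y y)"
  proof (intro sum.cong refl)
    fix v
    show "f v * B (v - y) (v - y) = f v * B v v - 2 * (f v * B y v) + f v * B y y"
      by (simp add: B.diff_left B.diff_right B_sym[of v y] algebra_simps)
  qed
  also have "\<dots> = (\<Sum>v\<in>V. f v * B v v) - 2 * (\<Sum>v\<in>V. f v * B y v) + sum f V * B y y"
    by (simp add: sum.distrib sum_subtractf sum_distrib_right flip: sum_distrib_left)
  also have "(\<Sum>v\<in>V. f v * B y v) = B y y"
    by (subst (3) y) (simp add: B.sum_right B.scaleR_right)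
  also have "(\<Sum>v\<in>V. f v * B v v) = B y y"
    using yV V_iff_q[of y] by (simp add: B_sum_V q_def flip: y)
  finally have "0 < (sum f V - 1) * B y y" by (simp add: algebra_simps)
  then show ?thesis using B_nonneg[of y] by (simp add: zero_less_mult_iff)
qed

text \<open>In the last case the complementary point \<open>y\<close> lies in \<open>V\<close> and its coefficients have sum above
  \<open>1\<close>, so trading a multiple of its expansion for the single vector \<open>y\<close> decreases the total.\<close>

lemma fractional_lattice_point_in_Semi:
  assumes dim: "DIM('a) \<le> 4" and x: "x \<in> X" "x = (\<Sum>v\<in>V. d v *\<^sub>R v)"
    and d: "\<And>v. v \<in> V \<Longrightarrow> 0 \<le> d v" "\<And>v. v \<in> V \<Longrightarrow> d v < 1"
    and indep: "independent {v \<in> V. d v \<noteq> 0}"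
    and minimal: "\<And>e. (\<And>v. v \<in> V \<Longrightarrow> 0 \<le> e v) \<Longrightarrow> (\<Sum>v\<in>V. e v *\<^sub>R v) = x \<Longrightarrow> sum d V \<le> sum e V"
  shows "x \<in> Semi V"
proof -
  define S where "S = {v \<in> V. d v \<noteq> 0}"
  have S: "finite S" "S \<subseteq> V" using finite_V by (auto simp: S_def)
  \<comment> \<open>Independence bounds the support by the dimension; this is where rank at most 4
    enters.\<close>
  have card: "card S \<le> 4" using independent_bound[OF indep] dim by (simp add: S_def)
  have sumS: "sum d V = sum d S" by (rule sum.mono_neutral_right) (use finite_V in \<open>auto simp: S_def\<close>)
  consider "sum d V < 2" | "sum d V = 2" | "2 < sum d V" by linarith
  then show ?thesis
  proof cases
    case 1
    then show ?thesis using rounding(1)[OF d(1) x(2) x(1)] by (auto intro: Semi_incl)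
  next
    case 2
    have "\<exists>v\<in>V. 0 < d v"
    proof (rule ccontr)
      assume "\<not> ?thesis"
      then have "sum d V \<le> 0" by (intro sum_nonpos) force
      then show False using 2 by simp
    qed
    then obtain v where v: "v \<in> V" "0 < d v" by blast
    \<comment> \<open>At total exactly 2, removing one vector of the support leaves a single element
      of \<open>V\<close>.\<close>
    have "x - v \<in> V" using rounding(2)[OF d(1) x(2) x(1) _ v] 2 by simp
    then have "v + (x - v) \<in> Semi V" using v by (intro Semi_add Semi_incl finite_V)
    then show ?thesis by simp
  next
    case 3
    \<comment> \<open>Complementing only on the support makes \<open>y\<close> equal to
      \<open>\<Sum>S - x\<close>, a lattice point.\<close>
    define f where "f v = (if v \<in> S then 1 - d v else 0)" for v
    define y where "y = (\<Sum>v\<in>V. f v *\<^sub>R v)"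
    have f0: "0 \<le> f v" if "v \<in> V" for v using d that by (simp add: f_def less_imp_le)
    have fpos: "0 < f v" if "v \<in> S" for v using d S that by (auto simp: f_def)
    have "y = (\<Sum>v\<in>S. f v *\<^sub>R v)"
      unfolding y_def by (rule sum.mono_neutral_right) (use finite_V S in \<open>auto simp: f_def\<close>)
    also have "\<dots> = \<Sum>S - (\<Sum>v\<in>S. d v *\<^sub>R v)"
      by (simp add: f_def scaleR_diff_left sum_subtractf)
    also have "(\<Sum>v\<in>S. d v *\<^sub>R v) = x"
      unfolding x(2) by (rule sum.mono_neutral_left) (use finite_V in \<open>auto simp: S_def\<close>)
    finally have "y = \<Sum>S - x" .
    moreover have "\<Sum>S \<in> X" using S V_subset by (intro full_lattice_sum[OF lattice]) auto
    ultimately have yX: "y \<in> X" using x(1) full_lattice_diff[OF lattice] by simp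
    have "sum f V = sum f S"
      by (rule sum.mono_neutral_right) (use finite_V S in \<open>auto simp: f_def\<close>)
    also have "\<dots> = real (card S) - sum d S" by (simp add: f_def sum_subtractf)
    \<comment> \<open>At most 4 minus a total above 2.\<close>
    finally have lt2: "sum f V < 2" using 3 card sumS by simp
    have yV: "y \<in> V" using rounding(1)[OF f0 y_def yX] lt2 by simp
    \<comment> \<open>\<open>sum_gt_1\<close> requires a support vector other than \<open>y\<close>;
      a single coefficient below 1 could not give a total above 2.\<close>
    have "S \<noteq> {y}"
    proof
      assume *: "S = {y}"
      then have "sum d S < 1" using d(2)[OF yV] by simp
      then show False using 3 sumS by simp
    qed
    moreover have "S \<noteq> {}" using 3 sumS by auto
    ultimately obtain w where w: "w \<in> S" "w \<noteq> y" by blast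
    have gt1: "1 < sum f V"
      using sum_gt_1[OF f0 y_def yV, of w] w fpos S by blast
    \<comment> \<open>The largest multiple of \<open>f\<close> that can be subtracted from
      \<open>d\<close> with nonnegative result.\<close>
    define t where "t = Min ((\<lambda>v. d v / f v) ` S)"
    have tle: "t \<le> d v / f v" if "v \<in> S" for v
      unfolding t_def using S that by (intro Min_le) auto
    have "t \<in> (\<lambda>v. d v / f v) ` S" unfolding t_def using S \<open>S \<noteq> {}\<close> by (intro Min_in) auto
    then have t0: "0 < t" using fpos d(1) by (force simp: S_def less_le)
    \<comment> \<open>Replacing \<open>t\<close> times the expansion of \<open>y\<close> by
      \<open>t\<close> times \<open>y\<close> keeps the point and changes the total by
      \<open>t * (1 - sum f V)\<close>, a negative number.\<close>
    define e where "e v = d v - t * f v + (if v = y then t else 0)" for v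
    have "0 \<le> e v" if "v \<in> V" for v
    proof -
      have "t * f v \<le> d v"
      proof (cases "v \<in> S")
        case True
        then show ?thesis using tle[OF True] fpos[OF True] by (simp add: field_simps)
      next
        case False
        then show ?thesis using d(1)[OF that] by (simp add: f_def)
      qed
      then show ?thesis using t0 by (simp add: e_def)
    qed
    moreover have "(\<Sum>v\<in>V. e v *\<^sub>R v) = x"
    proof -
      have "(\<Sum>v\<in>V. e v *\<^sub>R v) = x - t *\<^sub>R y + (\<Sum>v\<in>V. (if v = y then t else 0) *\<^sub>R v)"
        unfolding y_def x(2) e_def
        by (simp add: scaleR_add_left scaleR_diff_left sum.distrib sum_subtractf scaleR_sum_right)
      also have "(\<Sum>v\<in>V. (if v = y then t else 0) *\<^sub>R v) = (\<Sum>v\<in>V. if v = y then t *\<^sub>R v else 0)"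
        by (intro sum.cong) auto
      finally show ?thesis using yV finite_V by simp
    qed
    ultimately have "sum d V \<le> sum e V" by (rule minimal)
    also have "\<dots> = sum d V - t * sum f V + t"
      unfolding e_def using finite_V yV by (simp add: sum.distrib sum_subtractf sum_distrib_left)
    also have "\<dots> < sum d V" using t0 gt1 by simp
    finally show ?thesis by simp
  qed
qed

text \<open>Removing the floors of a minimal representation leaves a lattice point to which
  \<open>fractional_lattice_point_in_Semi\<close> applies.\<close>

lemma cone_lattice_points:
  assumes dim: "DIM('a) \<le> 4"
  shows "convex_cone hull V \<inter> X = Semi V"
proof
  show "Semi V \<subseteq> convex_cone hull V \<inter> X"
  proof
    fix x assume "x \<in> Semi V"
    then obtain c where c: "x = (\<Sum>v\<in>V. real (c v) *\<^sub>R v)" using finite_V by (auto simp: Semi_finite)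
    then have "x \<in> convex_cone hull V" unfolding convex_cone_hull_finite[OF finite_V]
      by (intro CollectI exI[of _ "\<lambda>v. real (c v)"]) simp
    moreover have "x \<in> X" unfolding c
      using V_subset by (intro full_lattice_sum[OF lattice] full_lattice_of_nat[OF lattice]) auto
    ultimately show "x \<in> convex_cone hull V \<inter> X" by blast
  qed
  show "convex_cone hull V \<inter> X \<subseteq> Semi V"
  proof
    fix x assume "x \<in> convex_cone hull V \<inter> X"
    then obtain c where xX: "x \<in> X" and c: "x = (\<Sum>v\<in>V. c v *\<^sub>R v)" "\<And>v. v \<in> V \<Longrightarrow> 0 \<le> c v"
      unfolding convex_cone_hull_finite[OF finite_V] by blast
    obtain d where d0: "\<forall>v\<in>V. 0 \<le> d v" and d: "(\<Sum>v\<in>V. d v *\<^sub>R v) = x"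
      and indep: "independent {v \<in> V. d v \<noteq> 0}"
      and minimal: "\<forall>e. (\<forall>v\<in>V. 0 \<le> e v) \<longrightarrow> (\<Sum>v\<in>V. e v *\<^sub>R v) = x \<longrightarrow> sum d V \<le> sum e V"
      using minimal_conic_representation[of V c, OF finite_V c(2), folded c(1)] by blast
    define n where "n v = nat \<lfloor>d v\<rfloor>" for v
    define z where "z = (\<Sum>v\<in>V. real (n v) *\<^sub>R v)"
    have n: "real (n v) = of_int \<lfloor>d v\<rfloor>" if "v \<in> V" for v using d0 that by (simp add: n_def)
    have zS: "z \<in> Semi V" unfolding z_def Semi_finite[OF finite_V] by blast
    have zX: "z \<in> X" unfolding z_def
      using V_subset by (intro full_lattice_sum[OF lattice] full_lattice_of_nat[OF lattice]) auto
    have "x - z \<in> Semi V"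
    proof (rule fractional_lattice_point_in_Semi[OF dim])
      show "x - z \<in> X" using xX zX full_lattice_diff[OF lattice] by blast
      show "x - z = (\<Sum>v\<in>V. (d v - real (n v)) *\<^sub>R v)"
        using d by (simp add: z_def scaleR_diff_left sum_subtractf)
      show "0 \<le> d v - real (n v)" "d v - real (n v) < 1" if "v \<in> V" for v
        using n[OF that] by linarith+
      \<comment> \<open>A zero coefficient has floor zero, so the support can only shrink.\<close>
      have "{v \<in> V. d v - real (n v) \<noteq> 0} \<subseteq> {v \<in> V. d v \<noteq> 0}" by (auto simp: n_def)
      then show "independent {v \<in> V. d v - real (n v) \<noteq> 0}" using indep independent_mono by blast
      show "(\<Sum>v\<in>V. d v - real (n v)) \<le> sum e V"
        if e: "\<And>v. v \<in> V \<Longrightarrow> 0 \<le> e v" "(\<Sum>v\<in>V. e v *\<^sub>R v) = x - z" for e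
      proof -
        \<comment> \<open>A cheaper expansion of \<open>x - z\<close>, with the integer parts added
          back, would beat \<open>d\<close>.\<close>
        have "sum d V \<le> (\<Sum>v\<in>V. e v + real (n v))"
          by (rule minimal[rule_format]) (use e in \<open>auto simp: scaleR_add_left sum.distrib z_def\<close>)
        then show ?thesis by (simp add: sum.distrib sum_subtractf)
      qed
    qed
    then have "z + (x - z) \<in> Semi V" using zS by (intro Semi_add finite_V)
    then show "x \<in> Semi V" by simp
  qed
qed

text \<open>The family \<open>T = {V}\<close> suffices: its members need not be convex, and a single finite set generates
  the whole cone.\<close>

lemma simplicially_generating_cell:
  assumes "DIM('a) \<le> 4" and "aff_dim (convex hull V) = int DIM('a)"
  shows "simplicially_generating X (convex hull V)"
proof -
  have "integral_body X (convex hull V)"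
    unfolding integral_body_def cell_lattice_points
    using finite_V by (simp add: finite_imp_compact_convex_hull compact_imp_bounded compact_imp_closed)
  moreover have "closed_cone V = convex_cone hull V"
    using finite_V by (simp add: closed_cone_def closed_convex_cone_hull)
  moreover have "V \<inter> X = V" using V_subset by blast
  ultimately show ?thesis
    unfolding simplicially_generating_def
    using assms zero_in_cell zero_in_V hull_subset[of V convex]
    by (intro conjI exI[of _ "{V}"])
      (simp_all add: cone_lattice_points closed_cone_convex_hull_finite[OF finite_V])
qed

text \<open>Full dimension and 0 in \<open>V\<close> make \<open>V\<close> span the space. A lattice
  point shifted far enough into the cone is then exhibited as a difference of two semigroup
  elements.\<close>

lemma int_span_cell:
  assumes dim: "DIM('a) \<le> 4" and full: "aff_dim (convex hull V) = int DIM('a)"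
  shows "X \<subseteq> int_span V"
proof
  fix x assume x: "x \<in> X"
  have "affine hull V = UNIV" using full by (simp add: aff_dim_eq_full)
  moreover have "affine hull V = span V" using zero_in_V by (intro affine_hull_span_0 hull_inc)
  ultimately obtain r where r: "x = (\<Sum>v\<in>V. r v *\<^sub>R v)" using span_finite[OF finite_V] by blast
  \<comment> \<open>\<open>N\<close> dominates every \<open>- r v\<close>; the inserted 0 keeps the
    set visibly nonempty.\<close>
  obtain N :: nat where N: "Max (insert 0 ((\<lambda>v. - r v) ` V)) \<le> real N" using real_arch_simple by blast
  have N': "0 \<le> r v + real N" if "v \<in> V" for v
  proof -
    have "- r v \<le> Max (insert 0 ((\<lambda>v. - r v) ` V))" using finite_V that by (intro Max_ge) auto
    then show ?thesis using N by linarith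
  qed
  \<comment> \<open>Adding \<open>z\<close> moves \<open>x\<close> into the cone.\<close>
  define z where "z = (\<Sum>v\<in>V. real N *\<^sub>R v)"
  have zS: "z \<in> Semi V"
    unfolding z_def Semi_finite[OF finite_V] by (intro CollectI exI[of _ "\<lambda>_. N"]) simp
  then have "z \<in> X" using cone_lattice_points[OF dim] by blast
  then have "x + z \<in> X" using x by (intro full_lattice_add[OF lattice])
  moreover have "x + z \<in> convex_cone hull V"
    unfolding convex_cone_hull_finite[OF finite_V]
    by (intro CollectI exI[of _ "\<lambda>v. r v + real N"])
      (use N' in \<open>auto simp: r z_def scaleR_add_left sum.distrib\<close>)
  ultimately have "x + z \<in> Semi V" using cone_lattice_points[OF dim] by blast
  then have "(x + z) - z \<in> int_span V"
    using zS Semi_subset_int_span[OF finite_V] by (intro int_span_diff finite_V) auto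
  then show "x \<in> int_span V" by simp
qed

lemma nilpotency_cell:
  assumes "DIM('a) \<le> 4" and "aff_dim (convex hull V) = int DIM('a)"
  shows "nilpotency X (convex hull V) = 1"
  unfolding nilpotency_def cell_lattice_points
  by (rule Least_equality) (use int_span_cell[OF assms] in auto)

end

theorem theorem1p3:
  fixes g :: nat and X :: "'a::euclidean_space set" and B :: "'a \<Rightarrow> 'a \<Rightarrow> real"
  assumes "g \<in> {1, 2, 3, 4}" and "DIM('a) = g"
    and "full_lattice X"
    and "pos_def_form B"
  shows "simplicially_generating_decomp X (Delaunay X B) \<and>
         nilpotency_decomp X (Delaunay X B) = 1"
proof -
  have dim: "DIM('a) \<le> 4" using assms(1,2) by auto
  have cell: "simplicially_generating X \<sigma> \<and> nilpotency X \<sigma> = 1"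
    if "\<sigma> \<in> full_cells_at_0 (Delaunay X B)" for \<sigma>
  proof -
    obtain \<alpha> where \<alpha>: "\<sigma> = convex hull (nearest X B \<alpha>)" "aff_dim \<sigma> = int DIM('a)" "0 \<in> \<sigma>"
      using \<open>\<sigma> \<in> _\<close> by (auto simp: full_cells_at_0_def Delaunay_def)
    interpret cell_at_0 X B \<alpha> by unfold_locales (use assms \<alpha> in auto)
    show ?thesis using simplicially_generating_cell nilpotency_cell dim \<alpha> by simp
  qed
  \<comment> \<open>Divisibility by the \<open>Lcm\<close> bound also covers an empty set of cells,
    and 1 is the only natural number dividing 1.\<close>
  then have "nilpotency_decomp X (Delaunay X B) dvd 1"
    unfolding nilpotency_decomp_def by (intro Lcm_least) auto
  then show ?thesis using cell by (simp add: simplicially_generating_decomp_def)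
qed

end
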